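(* Let $Y$ be a random vector in $\mathbb{R}^d$, $A\in\mathbb{R}^{d\times d}$ invertible, and $\varepsilon=AY$ with $\mathbb{E}\varepsilon=0$ and $\mathrm{var}(\varepsilon)=I_d$. Suppose that for some $r\ge 3$ (with $\mathbb{E}\|\varepsilon\|^r<\infty$) the tensor $h_r(\varepsilon)$ is diagonal with at most one zero on the diagonal. Then $A$ is identifiable up to permuting and swapping signs of its rows, i.e. $$\{B\in\mathbb{R}^{d\times d}\text{ invertible}: \mathrm{var}(BY)=I_d,\ h_r(BY)\text{ is diagonal}\}=\{QA: Q\in\mathrm{SP}(d)\}.$$
   Context: For a random vector $X$ in $\mathbb{R}^d$ with finite $r$-th moments, $h_r(X)$ denotes (one fixed choice throughout of) either the moment tensor $\mu_r(X)_{i_1\cdots i_r}=\mathbb{E}[X_{i_1}\cdots X_{i_r}]$ or the cumulant tensor $\kappa_r(X)_{i_1\cdots i_r}=\mathrm{cum}(X_{i_1},\dots,X_{i_r})=\sum_{\pi}(-1)^{|\pi|-1}(|\pi|-1)!\prod_{B\in\pi}\mathbb{E}\prod_{k\in B}X_{i_k}$ (sum over set partitions $\pi$ of $\{1,\dots,r\}$ with $|\pi|$ blocks). The theorem holds for either choice. A tensor $T$ is diagonal if $T_{i_1\cdots i_r}=0$ unless $i_1=\cdots=i_r$; its diagonal consists of the entries $T_{i\cdots i}$, $i=1,\dots,d$. $\mathrm{SP}(d)$ is the set of $d\times d$ signed permutation matrices, i.e. matrices $DP$ with $D$ diagonal with $\pm1$ diagonal entries and $P$ a permutation matrix. *)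

theory Defs
  imports "HOL-Probability.Probability"
begin

definition covariance_matrix :: "'a measure \<Rightarrow> ('a \<Rightarrow> real ^ 'd) \<Rightarrow> real ^ 'd ^ 'd" where
  "covariance_matrix M X =
    (\<chi> i j. integral\<^sup>L M (\<lambda>\<omega>. (X \<omega> $ i - integral\<^sup>L M (\<lambda>\<omega>. X \<omega> $ i)) *
                             (X \<omega> $ j - integral\<^sup>L M (\<lambda>\<omega>. X \<omega> $ j))))"

(* A tensor of order r over R^d is a function of an index map i :: nat => 'd, representing the
   index tuple (i 1, ..., i r); the tensors below never look at i outside {1..r}. *)

definition moment_tensor :: "'a measure \<Rightarrow> nat \<Rightarrow> ('a \<Rightarrow> real ^ 'd) \<Rightarrow> (nat \<Rightarrow> 'd) \<Rightarrow> real" where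
  "moment_tensor M r X i = integral\<^sup>L M (\<lambda>\<omega>. \<Prod>k\<in>{1..r}. X \<omega> $ i k)"

definition cumulant_tensor :: "'a measure \<Rightarrow> nat \<Rightarrow> ('a \<Rightarrow> real ^ 'd) \<Rightarrow> (nat \<Rightarrow> 'd) \<Rightarrow> real" where
  "cumulant_tensor M r X i =
    (\<Sum>\<pi> | partition_on {1..r} \<pi>. (- 1) ^ (card \<pi> - 1) * fact (card \<pi> - 1) *
       (\<Prod>B\<in>\<pi>. integral\<^sup>L M (\<lambda>\<omega>. \<Prod>k\<in>B. X \<omega> $ i k)))"

definition diagonal_tensor :: "nat \<Rightarrow> ((nat \<Rightarrow> 'd) \<Rightarrow> real) \<Rightarrow> bool" where
  "diagonal_tensor r T \<longleftrightarrow>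
    (\<forall>i. \<not> (\<forall>k\<in>{1..r}. \<forall>l\<in>{1..r}. i k = i l) \<longrightarrow> T i = 0)"

definition tensor_diag :: "((nat \<Rightarrow> 'd) \<Rightarrow> real) \<Rightarrow> 'd \<Rightarrow> real" where
  "tensor_diag T j = T (\<lambda>_. j)"

definition sign_matrix :: "real ^ 'd ^ 'd \<Rightarrow> bool" where
  "sign_matrix D \<longleftrightarrow>
    (\<forall>i. D $ i $ i = 1 \<or> D $ i $ i = - 1) \<and> (\<forall>i j. i \<noteq> j \<longrightarrow> D $ i $ j = 0)"

definition permutation_matrix :: "real ^ 'd ^ 'd \<Rightarrow> bool" where
  "permutation_matrix P \<longleftrightarrow>
    (\<exists>\<pi>. \<pi> permutes UNIV \<and> P = (\<chi> i j. if j = \<pi> i then 1 else 0))"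

definition signed_permutation_matrices :: "(real ^ 'd ^ 'd) set" where
  "signed_permutation_matrices = {D ** P | D P. sign_matrix D \<and> permutation_matrix P}"

end

theory Submission
  imports Defs
begin

text \<open>
  Both tensors are combinations of products of block moments over set partitions, hence multilinear
  in the random vector. Writing \<open>B = Q A\<close>, the covariance condition says that \<open>Q\<close> is orthogonal,
  and for distinct \<open>i\<close>, \<open>j\<close> the vanishing of the entries of \<open>h (B Y)\<close> with first two
  indices \<open>i\<close>, \<open>j\<close> reads \<open>\<Sum>\<^sub>a t\<^sub>a Q\<^sub>i\<^sub>a Q\<^sub>j\<^sub>a \<Prod>\<^sub>k Q\<^sub>l\<^sub>k\<^sub>a = 0\<close> for all remaining indices \<open>l\<close>, where \<open>t\<close> is
  the diagonal of \<open>h \<epsilon>\<close>. As \<open>r \<ge> 3\<close> there is at least one remaining index, and inverting \<open>Q\<close> in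
  the remaining slots one at a time gives \<open>t\<^sub>a Q\<^sub>i\<^sub>a Q\<^sub>j\<^sub>a = 0\<close> for each \<open>a\<close>. If
  \<open>t\<^sub>a = 0\<close> for a single \<open>a\<close>, then \<open>Q\<^sub>i\<^sub>a Q\<^sub>j\<^sub>a = 0\<close> also there, because rows \<open>i\<close> and
  \<open>j\<close> are orthogonal and all other products vanish. So every column of \<open>Q\<close> has one
  nonzero entry.
\<close>

section \<open>Products of sums over the blocks of a set partition\<close>

text \<open>Distributivity turns the product into a sum over families with one function per block.
  Since the blocks are disjoint and cover \<open>U\<close>, such families correspond bijectively to
  single functions on \<open>U\<close>.\<close>

lemma prod_sum_partition_on:
  fixes w :: "'k set \<Rightarrow> ('k \<Rightarrow> 'd) \<Rightarrow> 'b :: comm_semiring_1"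
  assumes "finite U" "partition_on U \<pi>" "finite T"
  shows "(\<Prod>B\<in>\<pi>. \<Sum>f\<in>B \<rightarrow>\<^sub>E T. w B f) = (\<Sum>g\<in>U \<rightarrow>\<^sub>E T. \<Prod>B\<in>\<pi>. w B (restrict g B))"
proof -
  have fin: "finite \<pi>" using assms finite_elements by blast
  have finB: "finite B" if "B \<in> \<pi>" for B
    using that assms(1) partition_onD1[OF assms(2)] by (auto intro: finite_subset)
  define blk where "blk k = (THE B. B \<in> \<pi> \<and> k \<in> B)" for k
  have blk: "blk k = B" if "B \<in> \<pi>" "k \<in> B" for k B
    unfolding blk_def using that partition_onD2[OF assms(2)]
    by (intro the_equality) (auto simp: disjoint_def)
  have blk2: "blk k \<in> \<pi> \<and> k \<in> blk k" if "k \<in> U" for k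
    using that blk partition_onD1[OF assms(2)] by auto
  have sub: "k \<in> U" if "B \<in> \<pi>" "k \<in> B" for k B
    using that partition_onD1[OF assms(2)] by auto
  have "(\<Prod>B\<in>\<pi>. \<Sum>f\<in>B \<rightarrow>\<^sub>E T. w B f)
      = (\<Sum>F\<in>(\<Pi>\<^sub>E B\<in>\<pi>. B \<rightarrow>\<^sub>E T). \<Prod>B\<in>\<pi>. w B (F B))"
    by (rule prod_sum_PiE) (use fin finB assms in \<open>auto intro!: finite_PiE\<close>)
  also have "\<dots> = (\<Sum>g\<in>U \<rightarrow>\<^sub>E T. \<Prod>B\<in>\<pi>. w B (restrict g B))"
  \<comment> \<open>The map \<open>j\<close> glues a family into one function by using, at each
    point, the member for the block containing that point; \<open>i\<close> restricts a function to
    the blocks.\<close>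
  proof (rule sum.reindex_bij_witness
      [where i = "\<lambda>g. \<lambda>B\<in>\<pi>. restrict g B" and j = "\<lambda>F. \<lambda>k\<in>U. F (blk k) k"], goal_cases)
    case (1 F)
    have "(\<lambda>B\<in>\<pi>. restrict (\<lambda>k\<in>U. F (blk k) k) B) B = F B" for B
    proof (cases "B \<in> \<pi>")
      case True
      then have "F B \<in> B \<rightarrow>\<^sub>E T" using 1 by auto
      then have "restrict (\<lambda>k\<in>U. F (blk k) k) B k = F B k" for k
        using True sub blk by (cases "k \<in> B") auto
      then show ?thesis using True by auto
    qed (use 1 in auto)
    then show ?case by blast
  next
    case (2 F)
    then show ?case using blk2 by (fastforce simp: PiE_iff)
  next
    case (3 g)
    then show ?case using blk2 by (auto simp: PiE_iff extensional_def fun_eq_iff)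
  next
    case (4 g)
    then show ?case using sub by (auto simp: PiE_iff)
  next
    case (5 F)
    have "restrict (\<lambda>k\<in>U. F (blk k) k) B = F B" if "B \<in> \<pi>" for B
    proof
      fix k
      have "F B \<in> B \<rightarrow>\<^sub>E T" using 5 that by auto
      then show "restrict (\<lambda>k\<in>U. F (blk k) k) B k = F B k"
        using that sub blk by (cases "k \<in> B") auto
    qed
    then show ?case by (intro prod.cong) auto
  qed
  finally show ?thesis .
qed

section \<open>Integrability of monomials\<close>

text \<open>The bound \<open>x ^ n \<le> 1 + x ^ r\<close> for \<open>x \<ge> 0\<close> suffices,
  since a finite measure makes the constant integrable.\<close>

lemma integrable_norm_power_mono:
  fixes X :: "'a \<Rightarrow> 'b :: real_normed_vector"
  assumes "finite_measure M" "(\<lambda>\<omega>. norm (X \<omega>)) \<in> borel_measurable M"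
    and "integrable M (\<lambda>\<omega>. norm (X \<omega>) ^ r)" "n \<le> r"
  shows "integrable M (\<lambda>\<omega>. norm (X \<omega>) ^ n)"
proof -
  interpret finite_measure M by fact
  show ?thesis
  proof (rule Bochner_Integration.integrable_bound)
    show "integrable M (\<lambda>\<omega>. 1 + norm (X \<omega>) ^ r)" using assms by auto
    show "(\<lambda>\<omega>. norm (X \<omega>) ^ n) \<in> borel_measurable M" using assms by measurable
    have "x ^ n \<le> 1 + x ^ r" if "x \<ge> 0" for x :: real
    proof (cases "x \<le> 1")
      case True
      then show ?thesis using that by (meson add_increasing2 power_le_one zero_le_power)
    next
      case False
      then have "x ^ n \<le> x ^ r" using assms by (intro power_increasing) auto
      then show ?thesis by simp
    qed
    then show "AE \<omega> in M. norm (norm (X \<omega>) ^ n) \<le> norm (1 + norm (X \<omega>) ^ r)"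
      by (auto simp: abs_of_nonneg)
  qed
qed

text \<open>Each coordinate is at most the norm in absolute value, so the product is dominated by
  the power of the norm with exponent \<open>card B\<close>.\<close>

lemma integrable_prod_components:
  fixes X :: "'a \<Rightarrow> real ^ 'd"
  assumes "finite_measure M" "X \<in> borel_measurable M"
    and "integrable M (\<lambda>\<omega>. norm (X \<omega>) ^ r)" "finite B" "card B \<le> r"
  shows "integrable M (\<lambda>\<omega>. \<Prod>k\<in>B. X \<omega> $ f k)"
proof (rule Bochner_Integration.integrable_bound)
  show "integrable M (\<lambda>\<omega>. norm (X \<omega>) ^ card B)"
    using integrable_norm_power_mono[OF assms(1) _ assms(3,5)] assms(2) by simp
  have [measurable]: "(\<lambda>\<omega>. X \<omega> $ i) \<in> borel_measurable M" for i
    by (rule measurable_compose[OF assms(2)])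
       (intro borel_measurable_continuous_onI continuous_intros)
  show "(\<lambda>\<omega>. \<Prod>k\<in>B. X \<omega> $ f k) \<in> borel_measurable M" by measurable
  have "\<bar>\<Prod>k\<in>B. X \<omega> $ f k\<bar> \<le> norm (X \<omega>) ^ card B" for \<omega>
  proof -
    have "\<bar>\<Prod>k\<in>B. X \<omega> $ f k\<bar> \<le> (\<Prod>k\<in>B. norm (X \<omega>))"
      unfolding abs_prod by (rule prod_mono) (auto simp: component_le_norm_cart)
    then show ?thesis by simp
  qed
  then show "AE \<omega> in M. norm (\<Prod>k\<in>B. X \<omega> $ f k) \<le> norm (norm (X \<omega>) ^ card B)"
    by (auto simp: abs_of_nonneg)
qed

section \<open>Multilinearity of the moment and cumulant tensors\<close>

text \<open>The contribution of one partition to the cumulant tensor, stripped of its coefficient.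
  For \<open>r > 0\<close> the one-block partition yields the moment tensor, so a single computation
  serves both choices of tensor.\<close>

definition partition_moment ::
  "'a measure \<Rightarrow> nat set set \<Rightarrow> ('a \<Rightarrow> real ^ 'd) \<Rightarrow> (nat \<Rightarrow> 'd) \<Rightarrow> real" where
  "partition_moment M \<pi> X i = (\<Prod>B\<in>\<pi>. integral\<^sup>L M (\<lambda>\<omega>. \<Prod>k\<in>B. X \<omega> $ i k))"

text \<open>Within a block the coordinates of \<open>Q *v X\<close> are expanded and integrated
  termwise, which is legitimate because a block has at most \<open>r\<close> elements. The sums for
  the separate blocks then merge into one sum over index maps on \<open>{1..r}\<close>.\<close>

lemma partition_moment_linear:
  fixes X :: "'a \<Rightarrow> real ^ 'd" and Q :: "real ^ 'd ^ 'd"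
  assumes M: "finite_measure M" "X \<in> borel_measurable M"
    and X: "integrable M (\<lambda>\<omega>. norm (X \<omega>) ^ r)" and \<pi>: "partition_on {1..r} \<pi>"
  shows "partition_moment M \<pi> (\<lambda>\<omega>. Q *v X \<omega>) i
    = (\<Sum>g\<in>{1..r} \<rightarrow>\<^sub>E UNIV. (\<Prod>k\<in>{1..r}. Q $ i k $ g k) * partition_moment M \<pi> X g)"
proof -
  have block: "integral\<^sup>L M (\<lambda>\<omega>. \<Prod>k\<in>B. (Q *v X \<omega>) $ i k)
      = (\<Sum>f\<in>B \<rightarrow>\<^sub>E UNIV. (\<Prod>k\<in>B. Q $ i k $ f k) * integral\<^sup>L M (\<lambda>\<omega>. \<Prod>k\<in>B. X \<omega> $ f k))"
    if "B \<in> \<pi>" for B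
  proof -
    have B: "B \<subseteq> {1..r}" using that partition_onD1[OF \<pi>] by auto
    then have fin: "finite B" and card: "card B \<le> r"
      using finite_subset card_mono[OF _ B] by auto
    have "(\<Prod>k\<in>B. (Q *v X \<omega>) $ i k)
        = (\<Sum>f\<in>B \<rightarrow>\<^sub>E UNIV. (\<Prod>k\<in>B. Q $ i k $ f k) * (\<Prod>k\<in>B. X \<omega> $ f k))" for \<omega>
      unfolding matrix_vector_mult_def
      by (simp add: prod_sum_PiE fin prod.distrib)
    then show ?thesis
      using integrable_prod_components[OF M X fin card] by simp
  qed
  have fin: "finite B" if "B \<in> \<pi>" for B
    by (rule finite_subset[of B "{1..r}"]) (use that partition_onD1[OF \<pi>] in blast, simp)
  \<comment> \<open>The coefficients collected over the blocks form one product over all slots that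
    does not depend on the partition. Summing over partitions therefore preserves the formula, which
    gives the cumulant case.\<close>
  have union: "(\<Prod>B\<in>\<pi>. \<Prod>k\<in>B. c k) = (\<Prod>k\<in>{1..r}. c k)" for c :: "nat \<Rightarrow> real"
    unfolding partition_onD1[OF \<pi>] using fin partition_onD2[OF \<pi>]
    by (subst prod.Union_disjoint) (auto simp: disjoint_def)
  have "partition_moment M \<pi> (\<lambda>\<omega>. Q *v X \<omega>) i
      = (\<Prod>B\<in>\<pi>. \<Sum>f\<in>B \<rightarrow>\<^sub>E UNIV.
          (\<Prod>k\<in>B. Q $ i k $ f k) * integral\<^sup>L M (\<lambda>\<omega>. \<Prod>k\<in>B. X \<omega> $ f k))"
    unfolding partition_moment_def by (intro prod.cong refl block)
  also have "\<dots> = (\<Sum>g\<in>{1..r} \<rightarrow>\<^sub>E UNIV. \<Prod>B\<in>\<pi>.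
      (\<Prod>k\<in>B. Q $ i k $ g k) * integral\<^sup>L M (\<lambda>\<omega>. \<Prod>k\<in>B. X \<omega> $ g k))"
    by (subst prod_sum_partition_on[OF _ \<pi>]) auto
  finally show ?thesis by (simp add: prod.distrib union partition_moment_def)
qed

lemma moment_tensor_linear:
  fixes X :: "'a \<Rightarrow> real ^ 'd" and Q :: "real ^ 'd ^ 'd"
  assumes "finite_measure M" "X \<in> borel_measurable M"
    and "integrable M (\<lambda>\<omega>. norm (X \<omega>) ^ r)" "r > 0"
  shows "moment_tensor M r (\<lambda>\<omega>. Q *v X \<omega>) i
    = (\<Sum>g\<in>{1..r} \<rightarrow>\<^sub>E UNIV. (\<Prod>k\<in>{1..r}. Q $ i k $ g k) * moment_tensor M r X g)"
proof -
  \<comment> \<open>Blocks are nonempty, so the one-block partition requires positive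
    \<open>r\<close>.\<close>
  have "partition_on {1..r} {{1..r}}" using assms(4) by (intro partition_on_space) auto
  from partition_moment_linear[OF assms(1-3) this] show ?thesis
    by (simp add: partition_moment_def moment_tensor_def)
qed

lemma cumulant_tensor_linear:
  fixes X :: "'a \<Rightarrow> real ^ 'd" and Q :: "real ^ 'd ^ 'd"
  assumes "finite_measure M" "X \<in> borel_measurable M"
    and "integrable M (\<lambda>\<omega>. norm (X \<omega>) ^ r)"
  shows "cumulant_tensor M r (\<lambda>\<omega>. Q *v X \<omega>) i
    = (\<Sum>g\<in>{1..r} \<rightarrow>\<^sub>E UNIV. (\<Prod>k\<in>{1..r}. Q $ i k $ g k) * cumulant_tensor M r X g)"
proof -
  have eq: "cumulant_tensor M r Z j = (\<Sum>\<pi> | partition_on {1..r} \<pi>.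
      (- 1) ^ (card \<pi> - 1) * fact (card \<pi> - 1) * partition_moment M \<pi> Z j)"
    for Z :: "'a \<Rightarrow> real ^ 'd" and j
    by (simp add: cumulant_tensor_def partition_moment_def)
  show ?thesis
    unfolding eq sum_distrib_left
    by (subst sum.swap)
       (auto simp: partition_moment_linear[OF assms] sum_distrib_left mult_ac intro!: sum.cong)
qed

section \<open>Transformation of diagonal tensors and of the covariance\<close>

text \<open>Only the constant index maps contribute, one for each coordinate \<open>a\<close>. The
  assumption \<open>cong\<close> bridges two encodings: the maps in the sum are
  \<open>undefined\<close> outside \<open>{1..r}\<close>, whereas \<open>tensor_diag\<close>
  evaluates \<open>T\<close> at a map constant on all of \<open>nat\<close>.\<close>

lemma sum_PiE_diagonal_tensor:
  fixes T :: "(nat \<Rightarrow> 'd :: finite) \<Rightarrow> real" and Q :: "real ^ 'd ^ 'd"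
  assumes "diagonal_tensor r T" "r > 0"
    and cong: "\<And>i j. (\<And>k. k \<in> {1..r} \<Longrightarrow> i k = j k) \<Longrightarrow> T i = T j"
  shows "(\<Sum>g\<in>{1..r} \<rightarrow>\<^sub>E UNIV. (\<Prod>k\<in>{1..r}. Q $ i k $ g k) * T g)
    = (\<Sum>a\<in>UNIV. tensor_diag T a * (\<Prod>k\<in>{1..r}. Q $ i k $ a))"
proof -
  let ?c = "\<lambda>a :: 'd. \<lambda>k :: nat\<in>{1..r}. a"
  have inj: "inj ?c"
  proof (rule injI)
    fix a b :: 'd assume "?c a = ?c b"
    then have "?c a 1 = ?c b 1" by (rule fun_cong)
    then show "a = b" using assms(2) by simp
  qed
  have "(\<Sum>g\<in>{1..r} \<rightarrow>\<^sub>E UNIV. (\<Prod>k\<in>{1..r}. Q $ i k $ g k) * T g)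
      = (\<Sum>g\<in>range ?c. (\<Prod>k\<in>{1..r}. Q $ i k $ g k) * T g)"
  proof (rule sum.mono_neutral_right)
    show "\<forall>g\<in>({1..r} \<rightarrow>\<^sub>E UNIV) - range ?c. (\<Prod>k\<in>{1..r}. Q $ i k $ g k) * T g = 0"
    proof
      fix g assume g: "g \<in> ({1..r} \<rightarrow>\<^sub>E UNIV) - range ?c"
      have "\<not> (\<forall>k\<in>{1..r}. \<forall>l\<in>{1..r}. g k = g l)"
      proof
        assume *: "\<forall>k\<in>{1..r}. \<forall>l\<in>{1..r}. g k = g l"
        have "g = ?c (g 1)"
        proof
          fix k
          show "g k = ?c (g 1) k"
          proof (cases "k \<in> {1..r}")
            case True
            then show ?thesis using *[rule_format, of k 1] assms(2) by simp
          next
            case False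
            then show ?thesis using g by (auto simp: PiE_iff extensional_def)
          qed
        qed
        then show False using g by blast
      qed
      then show "(\<Prod>k\<in>{1..r}. Q $ i k $ g k) * T g = 0"
        using assms(1) unfolding diagonal_tensor_def by auto
    qed
  qed (auto intro!: finite_PiE)
  also have "\<dots> = (\<Sum>a\<in>UNIV. (\<Prod>k\<in>{1..r}. Q $ i k $ ?c a k) * T (?c a))"
    by (subst sum.reindex[OF inj]) simp
  also have "\<dots> = (\<Sum>a\<in>UNIV. tensor_diag T a * (\<Prod>k\<in>{1..r}. Q $ i k $ a))"
  proof (rule sum.cong)
    fix a
    have "T (?c a) = T (\<lambda>_. a)" by (rule cong) simp
    then show "(\<Prod>k\<in>{1..r}. Q $ i k $ ?c a k) * T (?c a)
        = tensor_diag T a * (\<Prod>k\<in>{1..r}. Q $ i k $ a)"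
      by (simp add: tensor_diag_def)
  qed simp
  finally show ?thesis .
qed

text \<open>A linear image of a centred vector is centred, so both covariances are plain second
  moments and bilinear expansion applies.\<close>

lemma covariance_matrix_linear:
  fixes X :: "'a \<Rightarrow> real ^ 'd" and Q :: "real ^ 'd ^ 'd"
  assumes M: "finite_measure M" "X \<in> borel_measurable M"
    and X: "integrable M (\<lambda>\<omega>. norm (X \<omega>) ^ 2)" and mean: "integral\<^sup>L M X = 0"
  shows "covariance_matrix M (\<lambda>\<omega>. Q *v X \<omega>) = Q ** covariance_matrix M X ** transpose Q"
proof -
  have int1: "integrable M (\<lambda>\<omega>. X \<omega> $ i)" for i
    using integrable_prod_components[OF M X, of "{0::nat}" "\<lambda>_. i"] by simp
  \<comment> \<open>The two labels 0 and 1 keep both factors apart even when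
    \<open>i = j\<close>.\<close>
  have int2: "integrable M (\<lambda>\<omega>. X \<omega> $ i * X \<omega> $ j)" for i j
    using integrable_prod_components[OF M X, of "{0::nat, 1}" "\<lambda>k. if k = 0 then i else j"]
    by simp
  have "integrable M (\<lambda>\<omega>. norm (X \<omega>))"
    using integrable_norm_power_mono[of M X 2 1] M X by simp
  then have intX: "integrable M X" using M by (simp add: integrable_norm_iff)
  have mean0: "integral\<^sup>L M (\<lambda>\<omega>. X \<omega> $ i) = 0" for i
    using integral_bounded_linear[OF bounded_linear_vec_nth intX, of i] mean by simp
  have meanQ: "integral\<^sup>L M (\<lambda>\<omega>. (Q *v X \<omega>) $ i) = 0" for i
    by (simp add: matrix_vector_mult_def int1 mean0)
  have "integral\<^sup>L M (\<lambda>\<omega>. (Q *v X \<omega>) $ i * (Q *v X \<omega>) $ j)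
      = (\<Sum>b\<in>UNIV. (\<Sum>a\<in>UNIV. Q $ i $ a * integral\<^sup>L M (\<lambda>\<omega>. X \<omega> $ a * X \<omega> $ b)) * Q $ j $ b)"
    for i j
  proof -
    have "(Q *v X \<omega>) $ i * (Q *v X \<omega>) $ j
        = (\<Sum>b\<in>UNIV. \<Sum>a\<in>UNIV. Q $ i $ a * Q $ j $ b * (X \<omega> $ a * X \<omega> $ b))" for \<omega>
      unfolding matrix_vector_mult_def vec_lambda_beta sum_product
      by (subst sum.swap) (simp add: mult_ac)
    then have "integral\<^sup>L M (\<lambda>\<omega>. (Q *v X \<omega>) $ i * (Q *v X \<omega>) $ j)
        = (\<Sum>b\<in>UNIV. \<Sum>a\<in>UNIV. Q $ i $ a * Q $ j $ b * integral\<^sup>L M (\<lambda>\<omega>. X \<omega> $ a * X \<omega> $ b))"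
      by (simp add: int2)
    then show ?thesis by (simp add: sum_distrib_left ac_simps)
  qed
  then show ?thesis
    by (simp add: covariance_matrix_def mean0 meanQ matrix_matrix_mult_def transpose_def vec_eq_iff)
qed

section \<open>Orthogonal matrices\<close>

text \<open>Induction on the number of slots: fixing the last index at \<open>m\<close> absorbs
  \<open>Q $ m $ b\<close> into the coefficient, and some entry of column \<open>b\<close> is
  nonzero. The effective base case is one slot, where \<open>Q\<close> annihilates the coefficient
  vector; with no slot, only the sum of the coefficients would be known to vanish.\<close>

lemma orthogonal_products_eq_0:
  fixes Q :: "real ^ 'd ^ 'd"
  assumes Q: "orthogonal_matrix Q" and "n > 0"
    and "\<And>i :: nat \<Rightarrow> 'd. (\<Sum>a\<in>UNIV. c a * (\<Prod>k<n. Q $ i k $ a)) = 0"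
  shows "c b = 0"
  using assms(2,3)
proof (induction n arbitrary: c)
  case 0
  then show ?case by simp
next
  case (Suc n)
  have col: "transpose Q ** Q = mat 1" using Q by (simp add: orthogonal_matrix)
  show ?case
  proof (cases "n = 0")
    case True
    have "Q *v (\<chi> a. c a) = 0"
      using Suc.prems(2)[of "\<lambda>_. m" for m] True
      by (simp add: vec_eq_iff matrix_vector_mult_def mult.commute)
    then have "(transpose Q ** Q) *v (\<chi> a. c a) = 0"
      by (simp flip: matrix_vector_mul_assoc)
    then show ?thesis by (simp add: col vec_eq_iff)
  next
    case False
    have "c b * Q $ m $ b = 0" for m
    proof (rule Suc.IH)
      show "0 < n" using False by simp
      fix i :: "nat \<Rightarrow> 'd"
      have "(\<Prod>k<n. Q $ (i(n := m)) k $ a) = (\<Prod>k<n. Q $ i k $ a)" for a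
        by (rule prod.cong) auto
      then show "(\<Sum>a\<in>UNIV. c a * Q $ m $ a * (\<Prod>k<n. Q $ i k $ a)) = 0"
        using Suc.prems(2)[of "i(n := m)"] by (simp add: mult_ac)
    qed
    moreover have "\<exists>m. Q $ m $ b \<noteq> 0"
    proof (rule ccontr)
      assume "\<nexists>m. Q $ m $ b \<noteq> 0"
      then have "(transpose Q ** Q) $ b $ b = 0"
        by (simp add: matrix_matrix_mult_def transpose_def)
      then show False by (simp add: col mat_def)
    qed
    ultimately show ?thesis by auto
  qed
qed

lemma orthogonal_matrix_rows:
  fixes Q :: "real ^ 'd ^ 'd"
  assumes "orthogonal_matrix Q"
  shows "(\<Sum>a\<in>UNIV. Q $ i $ a * Q $ j $ a) = (if i = j then 1 else 0)"
proof -
  have "(Q ** transpose Q) $ i $ j = (if i = j then 1 else 0)"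
    using assms by (simp add: orthogonal_matrix_def mat_def)
  then show ?thesis by (simp add: matrix_matrix_mult_def transpose_def)
qed

section \<open>Signed permutation matrices\<close>

lemma diagonal_matrix_mult:
  fixes D P :: "'a :: semiring_1 ^ 'd ^ 'd"
  assumes "\<And>k. k \<noteq> i \<Longrightarrow> D $ i $ k = 0"
  shows "(D ** P) $ i $ j = D $ i $ i * P $ i $ j"
proof -
  have "(\<Sum>k\<in>UNIV. D $ i $ k * P $ k $ j) = (\<Sum>k\<in>{i}. D $ i $ k * P $ k $ j)"
    by (rule sum.mono_neutral_right) (auto simp: assms)
  then show ?thesis by (simp add: matrix_matrix_mult_def)
qed

text \<open>Rows have unit length, so each row \<open>i\<close> has a nonzero entry, in a column
  \<open>p i\<close>. The column condition makes \<open>p\<close> injective, hence a permutation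
  because the index type is finite.\<close>

lemma signed_permutation_matricesI:
  fixes Q :: "real ^ 'd ^ 'd"
  assumes Q: "orthogonal_matrix Q"
    and col: "\<And>i j a. i \<noteq> j \<Longrightarrow> Q $ i $ a * Q $ j $ a = 0"
  shows "Q \<in> signed_permutation_matrices"
proof -
  have "\<exists>a. Q $ i $ a \<noteq> 0" for i
    using orthogonal_matrix_rows[OF Q, of i i] by (intro ccontr[of "\<exists>a. Q $ i $ a \<noteq> 0"]) simp
  then obtain p where p: "\<And>i. Q $ i $ p i \<noteq> 0" by metis
  have inj: "inj p"
  proof (rule injI, rule ccontr)
    fix i j assume "p i = p j" "i \<noteq> j"
    then show False using col[of i j "p i"] p[of i] p[of j] by simp
  qed
  then have surj: "surj p" by (simp add: finite_UNIV_inj_surj)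
  with inj have perm: "p permutes UNIV" by (intro bij_imp_permutes) (auto simp: bij_def)
  have off: "Q $ i $ a = 0" if "a \<noteq> p i" for i a
  \<comment> \<open>By surjectivity, column \<open>a\<close> already has a nonzero entry in some row
    \<open>j\<close> other than \<open>i\<close>, so its entry in row \<open>i\<close> must
    vanish.\<close>
  proof -
    obtain j where "a = p j" using surj by (rule surjE)
    then show ?thesis using col[of i j a] p[of j] that by auto
  qed
  have diag: "Q $ i $ p i = 1 \<or> Q $ i $ p i = - 1" for i
  proof -
    have "(\<Sum>a\<in>UNIV. Q $ i $ a * Q $ i $ a) = (\<Sum>a\<in>{p i}. Q $ i $ a * Q $ i $ a)"
      by (rule sum.mono_neutral_right) (auto simp: off)
    then have "(Q $ i $ p i)\<^sup>2 = 1"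
      using orthogonal_matrix_rows[OF Q, of i i] by (simp add: power2_eq_square)
    then show ?thesis by (simp add: power2_eq_1_iff)
  qed
  define D :: "real ^ 'd ^ 'd" where "D = (\<chi> i j. if i = j then Q $ i $ p i else 0)"
  define P :: "real ^ 'd ^ 'd" where "P = (\<chi> i j. if j = p i then 1 else 0)"
  have "Q = D ** P"
    by (simp add: D_def P_def vec_eq_iff off diagonal_matrix_mult)
  moreover have "sign_matrix D" using diag by (simp add: D_def sign_matrix_def)
  moreover have "permutation_matrix P" using perm by (auto simp: P_def permutation_matrix_def)
  ultimately show ?thesis unfolding signed_permutation_matrices_def by blast
qed

text \<open>An entrywise normal form, with the sign condition stated as
  \<open>s i * s i = 1\<close>, the shape in which orthonormality of the rows uses it.\<close>

lemma signed_permutation_matricesE: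
  fixes Q :: "real ^ 'd ^ 'd"
  assumes "Q \<in> signed_permutation_matrices"
  obtains p s where "inj p" "\<And>i. s i * s i = 1" "Q = (\<chi> i j. if j = p i then s i else 0)"
proof -
  obtain D P p where Q: "Q = D ** P" and D: "sign_matrix D" and p: "p permutes UNIV"
    and P: "P = (\<chi> i j. if j = p i then 1 else 0)"
    using assms unfolding signed_permutation_matrices_def permutation_matrix_def by blast
  have "Q = (\<chi> i j. if j = p i then D $ i $ i else 0)"
    using D by (simp add: Q P sign_matrix_def vec_eq_iff diagonal_matrix_mult)
  moreover have "D $ i $ i * D $ i $ i = 1" for i
    using D unfolding sign_matrix_def by (metis mult_1 mult_minus1 minus_minus)
  ultimately show ?thesis using that[of p "\<lambda>i. D $ i $ i"] permutes_inj[OF p] by blast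
qed

lemma signed_permutation_matrix_column:
  fixes Q :: "real ^ 'd ^ 'd"
  assumes "Q \<in> signed_permutation_matrices" "i \<noteq> j"
  shows "Q $ i $ a * Q $ j $ a = 0"
proof -
  obtain p s where "inj p" and Q: "Q = (\<chi> i j. if j = p i then s i else 0)"
    using assms(1) by (rule signed_permutation_matricesE)
  then have "p i \<noteq> p j" using assms(2) by (simp add: inj_eq)
  then show ?thesis by (simp add: Q)
qed

lemma signed_permutation_matrix_orthogonal:
  fixes Q :: "real ^ 'd ^ 'd"
  assumes "Q \<in> signed_permutation_matrices"
  shows "orthogonal_matrix Q"
proof -
  obtain p s where p: "inj p" and s: "\<And>i. s i * s i = 1"
    and Q: "Q = (\<chi> i j. if j = p i then s i else 0)"
    by (rule signed_permutation_matricesE[OF assms]) (rule that)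
  have "(\<Sum>a\<in>UNIV. Q $ i $ a * Q $ j $ a) = (if i = j then 1 else 0)" for i j
  proof -
    have "(\<Sum>a\<in>UNIV. Q $ i $ a * Q $ j $ a) = (\<Sum>a\<in>{p i}. Q $ i $ a * Q $ j $ a)"
      by (rule sum.mono_neutral_right) (auto simp: Q)
    then show ?thesis using s by (simp add: Q inj_eq[OF p])
  qed
  then have "Q ** transpose Q = mat 1"
    by (simp add: matrix_matrix_mult_def transpose_def mat_def vec_eq_iff)
  then show ?thesis
    by (simp add: orthogonal_matrix_def matrix_left_right_inverse)
qed

section \<open>Orthogonal matrices preserving diagonality\<close>

lemma orthogonal_diagonalizing_column:
  fixes Q :: "real ^ 'd ^ 'd" and t :: "'d \<Rightarrow> real"
  assumes Q: "orthogonal_matrix Q" and r: "r \<ge> 3" and card: "card {a. t a = 0} \<le> 1"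
    and diag: "diagonal_tensor r (\<lambda>i. \<Sum>a\<in>UNIV. t a * (\<Prod>k\<in>{1..r}. Q $ i k $ a))"
    and "i \<noteq> j"
  shows "Q $ i $ a * Q $ j $ a = 0"
proof -
  have nz: "t b * Q $ i $ b * Q $ j $ b = 0" for b
  proof (rule orthogonal_products_eq_0[OF Q])
    show "r - 2 > 0" using r by simp
    fix l :: "nat \<Rightarrow> 'd"
    \<comment> \<open>Slots are numbered from 1: \<open>i\<close> and \<open>j\<close> occupy the
      first two, and the shift by 3 matches slots \<open>{3..r}\<close> with the index range
      \<open>{..<r - 2}\<close> of the free tuple \<open>l\<close>.\<close>
    define m where "m k = (if k = 1 then i else if k = 2 then j else l (k - 3))" for k :: nat
    have "(\<Prod>k\<in>{1..r}. Q $ m k $ b) = Q $ i $ b * Q $ j $ b * (\<Prod>k<r - 2. Q $ l k $ b)" for b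
    proof -
      have "{1..r} = insert 1 (insert 2 {3..r})" using r by auto
      then have "(\<Prod>k\<in>{1..r}. Q $ m k $ b) = Q $ i $ b * Q $ j $ b * (\<Prod>k\<in>{3..r}. Q $ m k $ b)"
        by (simp add: m_def)
      also have "(\<Prod>k\<in>{3..r}. Q $ m k $ b) = (\<Prod>k<r - 2. Q $ l k $ b)"
        by (rule prod.reindex_bij_witness[where i = "\<lambda>k. k + 3" and j = "\<lambda>k. k - 3"])
           (auto simp: m_def)
      finally show ?thesis .
    qed
    moreover have "m 1 \<noteq> m 2" using \<open>i \<noteq> j\<close> by (simp add: m_def)
    then have "\<not> (\<forall>k\<in>{1..r}. \<forall>l\<in>{1..r}. m k = m l)" using r by fastforce
    then have "(\<Sum>a\<in>UNIV. t a * (\<Prod>k\<in>{1..r}. Q $ m k $ a)) = 0"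
      using diag unfolding diagonal_tensor_def by blast
    ultimately show "(\<Sum>b\<in>UNIV. t b * Q $ i $ b * Q $ j $ b * (\<Prod>k<r - 2. Q $ l k $ b)) = 0"
      by (simp add: mult_ac)
  qed
  show ?thesis
  proof (cases "t a = 0")
    case True
    have "Q $ i $ b * Q $ j $ b = 0" if "b \<noteq> a" for b
    proof -
      have "t b \<noteq> 0"
        using True that card card_le_Suc0_iff_eq[of "{a. t a = 0}"] by auto
      then show ?thesis using nz[of b] by auto
    qed
    then have "(\<Sum>b\<in>UNIV. Q $ i $ b * Q $ j $ b) = (\<Sum>b\<in>{a}. Q $ i $ b * Q $ j $ b)"
      by (intro sum.mono_neutral_right) auto
    then show ?thesis using orthogonal_matrix_rows[OF Q, of i j] \<open>i \<noteq> j\<close> by simp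
  qed (use nz[of a] in auto)
qed

section \<open>Identifiability up to signed row permutations\<close>

theorem theorem5p5:
  fixes M :: "'a measure"
    and Y \<epsilon> :: "'a \<Rightarrow> real ^ 'd"
    and A :: "real ^ 'd ^ 'd"
    and r :: nat
    and h :: "('a \<Rightarrow> real ^ 'd) \<Rightarrow> (nat \<Rightarrow> 'd) \<Rightarrow> real"
  assumes "prob_space M"
    and "Y \<in> borel_measurable M"
    and "invertible A"
    and "\<epsilon> = (\<lambda>\<omega>. A *v Y \<omega>)"
    and "r \<ge> 3"
    and "integrable M (\<lambda>\<omega>. norm (\<epsilon> \<omega>) ^ r)"
    and "integral\<^sup>L M \<epsilon> = 0"
    and "covariance_matrix M \<epsilon> = mat 1"
    and "h = moment_tensor M r \<or> h = cumulant_tensor M r"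
    and "diagonal_tensor r (h \<epsilon>)"
    and "card {j. tensor_diag (h \<epsilon>) j = 0} \<le> 1"
  shows "{B :: real ^ 'd ^ 'd. invertible B
            \<and> covariance_matrix M (\<lambda>\<omega>. B *v Y \<omega>) = mat 1
            \<and> diagonal_tensor r (h (\<lambda>\<omega>. B *v Y \<omega>))}
       = {Q ** A | Q. Q \<in> signed_permutation_matrices}"
proof -
  interpret prob_space M by fact
  have meas: "\<epsilon> \<in> borel_measurable M"
    unfolding assms(4)
    by (rule measurable_compose[OF assms(2)])
       (intro borel_measurable_continuous_onI matrix_vector_mult_linear_continuous_on)
  have QA: "(Q ** A) *v Y \<omega> = Q *v \<epsilon> \<omega>" for Q \<omega>
    by (simp add: assms(4) matrix_vector_mul_assoc)
  have "integrable M (\<lambda>\<omega>. norm (\<epsilon> \<omega>) ^ 2)"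
    using integrable_norm_power_mono[of M \<epsilon> r 2] assms(5,6) meas finite_measure_axioms by simp
  \<comment> \<open>Since \<open>\<epsilon>\<close> has identity covariance, the transformed
    covariance is \<open>Q ** transpose Q\<close>; for square matrices a one-sided inverse is
    two-sided.\<close>
  from covariance_matrix_linear[OF finite_measure_axioms meas this assms(7)]
  have cov: "covariance_matrix M (\<lambda>\<omega>. Q *v \<epsilon> \<omega>) = mat 1 \<longleftrightarrow> orthogonal_matrix Q" for Q
    by (simp add: assms(8) orthogonal_matrix_def matrix_left_right_inverse)
  \<comment> \<open>All blocks lie in \<open>{1..r}\<close>, so neither tensor sees an index map
    outside that range.\<close>
  have cong: "h \<epsilon> i = h \<epsilon> j" if "\<And>k. k \<in> {1..r} \<Longrightarrow> i k = j k" for i j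
  proof -
    have "(\<Prod>k\<in>B. \<epsilon> \<omega> $ i k) = (\<Prod>k\<in>B. \<epsilon> \<omega> $ j k)" if "B \<subseteq> {1..r}" for B \<omega>
      using that \<open>\<And>k. k \<in> {1..r} \<Longrightarrow> i k = j k\<close> by (intro prod.cong) auto
    moreover have "B \<subseteq> {1..r}" if "partition_on {1..r} \<pi>" "B \<in> \<pi>" for \<pi> B
      using that partition_onD1 by blast
    ultimately show ?thesis
      using assms(9) by (auto simp: moment_tensor_def cumulant_tensor_def intro!: sum.cong prod.cong)
  qed
  have "h (\<lambda>\<omega>. Q *v \<epsilon> \<omega>) i
      = (\<Sum>g\<in>{1..r} \<rightarrow>\<^sub>E UNIV. (\<Prod>k\<in>{1..r}. Q $ i k $ g k) * h \<epsilon> g)" for Q i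
    using assms(9) moment_tensor_linear[OF finite_measure_axioms meas assms(6)]
      cumulant_tensor_linear[OF finite_measure_axioms meas assms(6)] assms(5) by auto
  then have hQ: "h (\<lambda>\<omega>. Q *v \<epsilon> \<omega>)
      = (\<lambda>i. \<Sum>a\<in>UNIV. tensor_diag (h \<epsilon>) a * (\<Prod>k\<in>{1..r}. Q $ i k $ a))" for Q
    using sum_PiE_diagonal_tensor[OF assms(10) _ cong] assms(5) by (simp add: fun_eq_iff)
  have "Q \<in> signed_permutation_matrices \<longleftrightarrow>
      orthogonal_matrix Q \<and> diagonal_tensor r (h (\<lambda>\<omega>. Q *v \<epsilon> \<omega>))" for Q
  proof
    assume Q: "Q \<in> signed_permutation_matrices"
    \<comment> \<open>A nonconstant tuple selects two distinct rows, and these cannot both be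
      nonzero in column \<open>a\<close>.\<close>
    have "(\<Prod>k\<in>{1..r}. Q $ i k $ a) = 0"
      if "\<not> (\<forall>k\<in>{1..r}. \<forall>l\<in>{1..r}. i k = i l)" for i a
      using that signed_permutation_matrix_column[OF Q, of _ _ a]
      by (auto simp: mult_eq_0_iff)
    then show "orthogonal_matrix Q \<and> diagonal_tensor r (h (\<lambda>\<omega>. Q *v \<epsilon> \<omega>))"
      using signed_permutation_matrix_orthogonal[OF Q]
      unfolding hQ diagonal_tensor_def by (auto intro!: sum.neutral simp del: prod_zero_iff)
  next
    assume Q: "orthogonal_matrix Q \<and> diagonal_tensor r (h (\<lambda>\<omega>. Q *v \<epsilon> \<omega>))"
    then have "Q $ i $ a * Q $ j $ a = 0" if "i \<noteq> j" for i j a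
      unfolding hQ using orthogonal_diagonalizing_column[OF _ assms(5,11) _ that] by blast
    then show "Q \<in> signed_permutation_matrices"
      using Q by (intro signed_permutation_matricesI) auto
  qed
  then have key: "Q \<in> signed_permutation_matrices \<longleftrightarrow>
      covariance_matrix M (\<lambda>\<omega>. (Q ** A) *v Y \<omega>) = mat 1
        \<and> diagonal_tensor r (h (\<lambda>\<omega>. (Q ** A) *v Y \<omega>))" for Q
    by (simp add: QA cov)
  have inv: "invertible (Q ** A)" if "Q \<in> signed_permutation_matrices" for Q
    using signed_permutation_matrix_orthogonal[OF that] assms(3)
    by (intro invertible_mult) (auto simp: orthogonal_matrix_def invertible_def)
  \<comment> \<open>A left inverse \<open>C\<close> of \<open>A\<close> writes every
    \<open>B\<close> as \<open>Q ** A\<close> with \<open>Q = B ** C\<close>, so classifying the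
    matrices \<open>Q\<close> loses no candidate.\<close>
  obtain C where "C ** A = mat 1"
    using assms(3) unfolding invertible_def by blast
  then have "B = (B ** C) ** A" for B :: "real ^ 'd ^ 'd"
    by (simp flip: matrix_mul_assoc)
  then have ex: "\<exists>Q. B = Q ** A" for B :: "real ^ 'd ^ 'd" by blast
  show ?thesis
  proof (intro set_eqI)
    fix B :: "real ^ 'd ^ 'd"
    obtain Q where B: "B = Q ** A" using ex by blast
    show "B \<in> {B. invertible B \<and> covariance_matrix M (\<lambda>\<omega>. B *v Y \<omega>) = mat 1
          \<and> diagonal_tensor r (h (\<lambda>\<omega>. B *v Y \<omega>))}
        \<longleftrightarrow> B \<in> {Q ** A | Q. Q \<in> signed_permutation_matrices}"
      unfolding mem_Collect_eq using key inv B by metis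
  qed
qed

end
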